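(* Let $\chi$ be a non-trivial Dirichlet character modulo $q$ and $r$ a non-negative integer. Then $$L(-r,\chi)=r!\,q^r\sum_{k=0}^{r}\frac{(-1)^{k-1}\alpha_k(-r)}{(r+1-k)!}\sum_{m=1}^{q-1}\chi(m)\,(m/q-1)(m/q-2)\cdots(m/q+k-r-1).$$
   Context: For $s\in\mathbb{C}$ the coefficients $\alpha_k(s)$ are defined by $\left(\frac{-\log(1-t)}{t}\right)^{s-1}=\sum_{k=0}^\infty\alpha_k(s)t^k$ for $|t|<1$ (branch equal to $1$ at $t=0$). $L(s,\chi)$ is the Dirichlet $L$-function, analytically continued. The product $(m/q-1)\cdots(m/q+k-r-1)$ consists of the $r+1-k$ factors $m/q-i$ for $i=1,\dots,r+1-k$. *)

theory Defs
  imports "HOL-Complex_Analysis.Complex_Analysis"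
begin

definition dirichlet_character :: "nat \<Rightarrow> (nat \<Rightarrow> complex) \<Rightarrow> bool" where
  "dirichlet_character q chi \<longleftrightarrow> q > 0 \<and>
     (\<forall>m n. chi (m * n) = chi m * chi n) \<and>
     (\<forall>n. chi (n + q) = chi n) \<and>
     (\<forall>n. chi n = 0 \<longleftrightarrow> \<not> coprime n q) \<and>
     chi 1 = 1"

definition nontrivial_character :: "nat \<Rightarrow> (nat \<Rightarrow> complex) \<Rightarrow> bool" where
  "nontrivial_character q chi \<longleftrightarrow> (\<exists>n. coprime n q \<and> chi n \<noteq> 1)"

text \<open>Dirichlet L-function, analytically continued: the (unique) entire function
  agreeing with the Dirichlet series on Re s > 1 (for non-trivial chi this is entire).\<close>
definition dirichlet_L :: "(nat \<Rightarrow> complex) \<Rightarrow> complex \<Rightarrow> complex" where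
  "dirichlet_L chi = (THE f. f holomorphic_on UNIV \<and>
      (\<forall>s. Re s > 1 \<longrightarrow> f s = (\<Sum>n. chi (Suc n) / (of_nat (Suc n)) powr s)))"

text \<open>The function t \<mapsto> ((-log(1-t))/t)^(s-1) on the unit disc, principal branch
  (the base has positive real part on the disc and equals 1 at t = 0).\<close>
definition alpha_fun :: "complex \<Rightarrow> complex \<Rightarrow> complex" where
  "alpha_fun s t = (if t = 0 then 1 else exp ((s - 1) * Ln (- Ln (1 - t) / t)))"

definition alpha :: "nat \<Rightarrow> complex \<Rightarrow> complex" where
  "alpha k s = (deriv ^^ k) (alpha_fun s) 0 / fact k"

end

theory Submission
  imports Defs
begin

text \<open>
  Let \<open>E\<close> be the shift \<open>f (x) \<mapsto> f (x + 1)\<close>. Formally \<open>L(s, chi)\<close> is \<open>S(E) / (1 - E ^ q)\<close> applied to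
  \<open>x powr - s\<close> at \<open>x = 1\<close>, where \<open>S(X) = (\<Sum>m<q. chi (m + 1) * X ^ m)\<close>. Since \<open>S(1) = 0\<close>, for every \<open>N\<close>
  one can write \<open>S = (1 - X ^ q) * C + (X - 1) ^ N * V\<close>. Summing over blocks of length \<open>q\<close>, the first
  part telescopes to \<open>C(E)\<close> applied at \<open>1\<close>, and the second gives a series of \<open>N\<close>-th differences, of
  size \<open>O(x powr (- Re s - N))\<close>; this continues \<open>L\<close> to \<open>Re s > 1 - N\<close>. At \<open>s = - r\<close> with \<open>N\<close> large, the
  differences vanish, and if \<open>P\<close> is a polynomial with \<open>P(x + q) - P(x) = x ^ r\<close> then
  \<open>L(- r, chi) = - (\<Sum>m. chi m * P(m))\<close>.

  The right-hand side of the theorem is of this form, with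
  \<open>P(x) = r! q ^ r (\<Sum>k\<le>r. (- 1) ^ k * alpha k (- r) * ((x / q - 1) gchoose (r + 1 - k)))\<close>. By
  Pascal's rule, the difference equation reduces to
  \<open>(\<Sum>k\<le>r. (- 1) ^ k * alpha k (- r) * ((y - 1) gchoose (r - k))) = y ^ r / r!\<close>, which is a Lagrange
  inversion: it computes the residue of \<open>w powi (- r - 1) * (1 - t) powr (y - 1)\<close> at \<open>0\<close>, where
  \<open>w = - ln (1 - t)\<close>, in the coordinate \<open>w\<close>.
\<close>

section \<open>The coefficients \<open>alpha\<close> at non-positive integers\<close>

unbundle fps_syntax
unbundle no vec_syntax

text \<open>The hypotheses make \<open>W\<close> the series of -log(1 - t), so the left side is (1 -
  t)^y / (1 - t) = (1 - t)^(y - 1). Its coefficients come from the recursion that (1 - t) e' = - y e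
  imposes on e = (1 - t)^y.\<close>

lemma fps_exp_compose_deriv_eq_binomial:
  fixes W :: "complex fps"
  assumes W: "(1 - fps_X) * fps_deriv W = 1" and W0: "W $ 0 = 0"
  shows "(fps_exp (- y) oo W) * fps_deriv W = Abs_fps (\<lambda>n. (-1) ^ n * ((y - 1) gchoose n))"
proof -
  define e where "e = fps_exp (- y) oo W"
  define D where "D = Abs_fps (\<lambda>n. (-1) ^ n * ((y - 1) gchoose n))"
  have "fps_deriv e = fps_const (- y) * (e * fps_deriv W)"
    using W0 by (simp add: e_def fps_compose_deriv fps_compose_mult_distrib mult.assoc)
  then have "(1 - fps_X) * fps_deriv e = fps_const (- y) * e * ((1 - fps_X) * fps_deriv W)"
    by (simp add: algebra_simps)
  then have ode: "(1 - fps_X) * fps_deriv e = fps_const (- y) * e"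
    by (simp add: W)
  have e_nth: "e $ n = (-1) ^ n * (y gchoose n)" for n
  proof (induction n)
    case 0
    show ?case by (simp add: e_def)
  next
    case (Suc n)
    have "((1 - fps_X) * fps_deriv e) $ n = - y * e $ n"
      by (simp add: ode)
    moreover have "((1 - fps_X) * fps_deriv e) $ n = of_nat (Suc n) * e $ Suc n - of_nat n * e $ n"
      by (cases n) (simp_all add: algebra_simps)
    ultimately have "of_nat (Suc n) * e $ Suc n = (of_nat n - y) * e $ n"
      by (simp add: algebra_simps)
    also have "\<dots> = (-1) ^ Suc n * ((y - of_nat n) * (y gchoose n))"
      by (simp add: Suc algebra_simps)
    also have "(y - of_nat n) * (y gchoose n) = of_nat (Suc n) * (y gchoose Suc n)"
      using gbinomial_absorb_comp[of y n] gbinomial_absorption[of n y] by simp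
    finally have "of_nat (Suc n) * e $ Suc n = of_nat (Suc n) * ((-1) ^ Suc n * (y gchoose Suc n))"
      by (simp only: mult.left_commute)
    then show ?case
      by (simp only: mult_cancel_left of_nat_eq_0_iff) simp
  qed
  \<comment> \<open>Pascal's rule expresses multiplication by 1 - t, which raises the exponent from
    y - 1 to y.\<close>
  have "D * (1 - fps_X) = e"
  proof (rule fps_ext)
    fix n
    show "(D * (1 - fps_X)) $ n = e $ n"
    proof (cases n)
      case 0
      then show ?thesis by (simp add: e_nth D_def)
    next
      case (Suc m)
      have "y gchoose Suc m = ((y - 1) gchoose m) + ((y - 1) gchoose Suc m)"
        using gbinomial_Suc_Suc[of "y - 1" m] by simp
      then show ?thesis
        by (simp add: Suc e_nth D_def right_diff_distrib algebra_simps)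
    qed
  qed
  then have "e * fps_deriv W = D * ((1 - fps_X) * fps_deriv W)"
    by (simp add: mult.assoc)
  then show ?thesis
    by (simp add: W e_def D_def)
qed

text \<open>With \<open>A\<close> = t/w this is the residue of w^(-n-1) dw, which is exact unless n
  = 0. Without Laurent series: for n > 0, differentiating \<open>W * A = fps_X\<close> gives A^(n+1)
  W' = A^n - t A^(n-1) A', and the t^n coefficients on the right cancel because (A^n)' = n A^(n-1)
  A'.\<close>

lemma fps_power_mult_deriv_nth:
  fixes A W :: "complex fps"
  assumes AW: "W * A = fps_X" and A0: "A $ 0 * fps_deriv W $ 0 = 1"
  shows "(A ^ Suc n * fps_deriv W) $ n = (if n = 0 then 1 else 0)"
proof (cases n)
  case 0
  then show ?thesis using A0 by simp
next
  case (Suc m)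
  have "fps_deriv (W * A) = 1" by (simp add: AW)
  then have "A * fps_deriv W = 1 - W * fps_deriv A"
    by (simp add: algebra_simps)
  then have "A ^ Suc n * fps_deriv W = A ^ n * (1 - W * fps_deriv A)"
    by (metis power_Suc2 mult.assoc)
  also have "\<dots> = A ^ n - A ^ m * ((W * A) * fps_deriv A)"
    by (simp add: Suc algebra_simps)
  also have "\<dots> = A ^ n - fps_X * (A ^ m * fps_deriv A)"
    by (simp only: AW mult.left_commute)
  finally have eq: "A ^ Suc n * fps_deriv W = A ^ n - fps_X * (A ^ m * fps_deriv A)" .
  have "fps_deriv (A ^ n) = fps_const (of_nat n) * (A ^ m * fps_deriv A)"
    by (simp only: fps_deriv_power Suc diff_Suc_1 mult.assoc mult.commute[of "fps_deriv A"])
  then have "fps_deriv (A ^ n) $ m = of_nat n * (A ^ m * fps_deriv A) $ m"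
    by (simp only: fps_mult_left_const_nth)
  then have "of_nat n * (A ^ n) $ n = of_nat n * (A ^ m * fps_deriv A) $ m"
    by (simp only: Suc fps_deriv_nth Suc_eq_plus1)
  then have "(A ^ n) $ n = (A ^ m * fps_deriv A) $ m"
    by (simp add: Suc del: of_nat_Suc)
  then show ?thesis
    unfolding eq by (simp add: Suc del: power_Suc)
qed

text \<open>Lagrange inversion: the binomial series is exp(-y W) W', expanded in powers of W. For i
  <= r, W^i A^(r+1) W' = t^i A^(r-i+1) W' has a nonzero t^r coefficient only when i = r, by the
  residue computation.\<close>

lemma fps_power_mult_binomial_nth:
  fixes A W :: "complex fps"
  assumes AW: "W * A = fps_X" and W: "(1 - fps_X) * fps_deriv W = 1" and W0: "W $ 0 = 0"
  shows "(A ^ Suc r * Abs_fps (\<lambda>n. (-1) ^ n * ((y - 1) gchoose n))) $ r = (- y) ^ r / fact r"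
proof -
  define e where "e = fps_exp (- y) oo W"
  define c where "c = (\<lambda>i. (- y) ^ i / fact i)"
  have "((1 - fps_X) * fps_deriv W) $ 0 = 1" by (simp add: W)
  then have dW0: "fps_deriv W $ 0 = 1" by simp
  have "(W * A) $ 1 = 1" by (simp add: AW)
  then have A0: "A $ 0 * fps_deriv W $ 0 = 1"
    using W0 dW0 by (simp add: fps_mult_nth)
  \<comment> \<open>W^i has no terms below t^i, so the sum can run to the common bound
    \<open>r\<close>, which allows the sums to be exchanged.\<close>
  have e_nth: "e $ k = (\<Sum>i\<le>r. c i * (W ^ i) $ k)" if "k \<le> r" for k
  proof -
    have "e $ k = (\<Sum>i\<in>{0..k}. c i * (W ^ i) $ k)"
      by (simp add: e_def fps_compose_nth c_def)
    also have "\<dots> = (\<Sum>i\<le>r. c i * (W ^ i) $ k)"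
      using that W0 by (intro sum.mono_neutral_left) (auto simp: startsby_zero_power_prefix)
    finally show ?thesis .
  qed
  define B where "B = A ^ Suc r * fps_deriv W"
  have term_eq: "(W ^ i * B) $ r = (if i = r then 1 else 0)" if "i \<le> r" for i
  proof -
    have "W ^ i * B = (W * A) ^ i * (A ^ Suc (r - i) * fps_deriv W)"
      using that by (simp add: B_def power_mult_distrib mult.assoc mult.left_commute
          flip: power_add power_Suc)
    then have "(W ^ i * B) $ r = (A ^ Suc (r - i) * fps_deriv W) $ (r - i)"
      using that by (simp add: AW fps_X_power_mult_nth del: power_Suc)
    also have "\<dots> = (if r - i = 0 then 1 else 0)"
      by (rule fps_power_mult_deriv_nth[OF AW A0])
    finally show ?thesis using that by simp
  qed
  have "(e * B) $ r = (\<Sum>k=0..r. (\<Sum>i\<le>r. c i * (W ^ i) $ k) * B $ (r - k))"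
    by (simp add: fps_mult_nth e_nth)
  also have "\<dots> = (\<Sum>i\<le>r. c i * (W ^ i * B) $ r)"
    by (simp add: fps_mult_nth sum_distrib_left sum_distrib_right mult.assoc)
       (rule sum.swap)
  also have "\<dots> = (\<Sum>i\<le>r. if i = r then c i else 0)"
    by (intro sum.cong) (auto simp: term_eq)
  also have "\<dots> = c r" by simp
  finally have "(A ^ Suc r * (e * fps_deriv W)) $ r = c r"
    by (simp only: B_def mult.left_commute)
  then show ?thesis
    by (simp only: e_def fps_exp_compose_deriv_eq_binomial[OF W W0] c_def)
qed

text \<open>At s = -r the exponent s - 1 is the negative integer -(r + 1), so the branch of the
  logarithm drops out and \<open>alpha_fun\<close> is (t/w)^(r+1) near 0, where w = -log(1 - t).
  \<open>W\<close> and \<open>A\<close> expand w and t/w and serve all r at once.\<close>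

lemma alpha_eq_fps_power_nth:
  obtains W A :: "complex fps"
  where "W * A = fps_X" "(1 - fps_X) * fps_deriv W = 1" "W $ 0 = 0"
    "\<And>r k. alpha k (- of_nat r) = (A ^ Suc r) $ k"
proof -
  define w where "w = (\<lambda>t::complex. - Ln (1 - t))"
  have "w holomorphic_on ball 0 1"
    unfolding w_def
    by (intro holomorphic_intros)
      (auto simp: complex_nonpos_Reals_iff dest!: complex_Re_le_cmod[THEN order.strict_trans1])
  then have "w analytic_on {0}"
    using analytic_at_ball by (metis analytic_at centre_in_ball open_ball zero_less_one)
  then obtain W where W: "w has_fps_expansion W"
    using analytic_at_imp_has_fps_expansion_0 by blast
  have W0: "W $ 0 = 0"
    using fps_nth_fps_expansion[OF W, of 0] by (simp add: w_def)
  have near: "eventually (\<lambda>t::complex. t \<in> ball 0 1) (nhds 0)"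
    by (intro eventually_nhds_in_open) auto
  have dw: "(w has_field_derivative 1 / (1 - t)) (at t)" if "t \<in> ball 0 1" for t
  proof -
    have "1 - t \<notin> \<real>\<^sub>\<le>\<^sub>0"
      using that complex_Re_le_cmod[of t] by (auto simp: complex_nonpos_Reals_iff)
    then show ?thesis unfolding w_def
      by (auto intro!: derivative_eq_intros simp: divide_simps)
  qed
  have "(\<lambda>t. (1 - t) * deriv w t) has_fps_expansion (1 - fps_X) * fps_deriv W"
    by (intro fps_expansion_intros W)
  moreover have "eventually (\<lambda>t. (1 - t) * deriv w t = 1) (nhds 0)"
    using near by eventually_elim (use dw DERIV_imp_deriv in fastforce)
  ultimately have "(\<lambda>_. 1) has_fps_expansion (1 - fps_X) * fps_deriv W"
    by (subst has_fps_expansion_cong[symmetric]) auto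
  then have W': "(1 - fps_X) * fps_deriv W = 1"
    using fps_expansion_unique_complex has_fps_expansion_1 by blast
  then have "((1 - fps_X) * fps_deriv W) $ 0 = 1" by simp
  then have W1: "W $ 1 = 1" by simp
  have Wnz: "W \<noteq> 0" and sd: "subdegree W = 1"
    using W1 W0 by (auto intro: subdegreeI)
  define A where "A = fps_X / W"
  have "(\<lambda>t. if t = 0 then 1 else t / w t) has_fps_expansion A"
    unfolding A_def
    by (rule has_fps_expansion_divide) (use W Wnz sd W1 in \<open>auto intro: fps_expansion_intros\<close>)
  then have A: "(\<lambda>t. (if t = 0 then 1 else t / w t) ^ Suc r) has_fps_expansion A ^ Suc r" for r
    by (intro fps_expansion_intros)
  have AW: "W * A = fps_X"
    unfolding A_def using sd Wnz by (simp add: fps_dvd_iff)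
  have w_nz: "w t \<noteq> 0" if "t \<in> ball 0 1" "t \<noteq> 0" for t
  proof
    assume "w t = 0"
    then have "exp (Ln (1 - t)) = 1" by (simp add: w_def)
    moreover have "1 - t \<noteq> 0" using that by auto
    ultimately show False using that by simp
  qed
  have "alpha_fun (- of_nat r) has_fps_expansion A ^ Suc r" for r
  proof (rule has_fps_expansion_cong[THEN iffD1, OF _ refl A])
    show "eventually (\<lambda>t. (if t = 0 then 1 else t / w t) ^ Suc r = alpha_fun (- of_nat r) t) (nhds 0)"
      using near
    proof eventually_elim
      case (elim t)
      show ?case
      proof (cases "t = 0")
        case False
        then have nz: "w t / t \<noteq> 0" using w_nz elim by auto
        have "alpha_fun (- of_nat r) t = exp (- (of_nat (Suc r) * Ln (w t / t)))"
          using False by (simp add: alpha_fun_def w_def algebra_simps minus_diff_commute)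
        also have "\<dots> = inverse ((w t / t) ^ Suc r)"
          using nz by (simp only: exp_minus exp_of_nat_mult exp_Ln not_False_eq_True)
        also have "\<dots> = (t / w t) ^ Suc r"
          by (simp add: power_divide inverse_eq_divide)
        finally show ?thesis using False by simp
      qed (simp add: alpha_fun_def)
    qed
  qed
  then have "alpha k (- of_nat r) = (A ^ Suc r) $ k" for r k
    unfolding alpha_def by (rule fps_nth_fps_expansion[symmetric])
  with AW W' W0 show thesis using that by blast
qed

text \<open>The Lagrange inversion read as a Cauchy product; multiplying by (-1)^r turns the signs
  (-1)^(r-k) into (-1)^k and (-y)^r into y^r.\<close>

lemma sum_alpha_gbinomial:
  "(\<Sum>k=0..r. (-1) ^ k * alpha k (- of_nat r) * ((y - 1) gchoose (r - k))) = y ^ r / fact r"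
proof -
  obtain W A :: "complex fps"
    where "W * A = fps_X" "(1 - fps_X) * fps_deriv W = 1" "W $ 0 = 0"
      and alpha: "\<And>r k. alpha k (- of_nat r) = (A ^ Suc r) $ k"
    by (rule alpha_eq_fps_power_nth, rule that)
  then have "(\<Sum>k=0..r. alpha k (- of_nat r) * ((-1) ^ (r - k) * ((y - 1) gchoose (r - k))))
      = (- y) ^ r / fact r" (is "?S = _")
    using fps_power_mult_binomial_nth[of W A r y] by (simp only: fps_mult_nth alpha fps_nth_Abs_fps)
  then have "(-1) ^ r * ?S = y ^ r / fact r"
    by (simp add: flip: power_mult_distrib)
  moreover have "(-1) ^ r * ?S =
      (\<Sum>k=0..r. (-1) ^ k * alpha k (- of_nat r) * ((y - 1) gchoose (r - k)))"
    unfolding sum_distrib_left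
  proof (intro sum.cong refl)
    fix k assume "k \<in> {0..r}"
    then obtain d where "r = k + d" by (auto simp: le_iff_add)
    then have sgn: "(-1 :: complex) ^ r * (-1) ^ (r - k) = (-1) ^ k"
      by (simp add: power_add mult.assoc flip: power_mult_distrib)
    show "(-1) ^ r * (alpha k (- of_nat r) * ((-1) ^ (r - k) * ((y - 1) gchoose (r - k))))
        = (-1) ^ k * alpha k (- of_nat r) * ((y - 1) gchoose (r - k))"
      unfolding sgn[symmetric] by (simp only: mult_ac)
  qed
  ultimately show ?thesis by simp
qed

section \<open>Polynomials in the shift operator\<close>

text \<open>This is p(E) f for the shift E, folded by Horner's scheme so that each
  \<open>pCons\<close> costs one shift of the argument.\<close>

definition shift_poly :: "complex poly \<Rightarrow> (complex \<Rightarrow> complex) \<Rightarrow> complex \<Rightarrow> complex" where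
  "shift_poly p f = fold_coeffs (\<lambda>a g x. a * f x + g (x + 1)) p (\<lambda>_. 0)"

lemma shift_poly_0 [simp]: "shift_poly 0 f x = 0"
  by (simp add: shift_poly_def)

lemma shift_poly_pCons [simp]: "shift_poly (pCons a p) f x = a * f x + shift_poly p f (x + 1)"
  by (cases "p = 0 \<and> a = 0") (auto simp: shift_poly_def)

lemma shift_poly_add: "shift_poly (p + q) f x = shift_poly p f x + shift_poly q f x"
  by (induction p q arbitrary: x rule: poly_induct2) (simp_all add: algebra_simps)

lemma shift_poly_smult: "shift_poly (smult c p) f x = c * shift_poly p f x"
  by (induction p arbitrary: x) (simp_all add: algebra_simps)

lemma shift_poly_diff: "shift_poly (p - q) f x = shift_poly p f x - shift_poly q f x"
  using shift_poly_add[of p "smult (-1) q" f x] shift_poly_smult[of "-1" q f x] by simp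

lemma shift_poly_sum: "shift_poly (\<Sum>i\<in>I. p i) f x = (\<Sum>i\<in>I. shift_poly (p i) f x)"
  by (induction I rule: infinite_finite_induct) (simp_all add: shift_poly_add)

lemma shift_poly_monom: "shift_poly (monom c n) f x = c * f (x + of_nat n)"
  by (induction n arbitrary: x) (simp_all add: monom_0 monom_Suc algebra_simps)

lemma shift_poly_one [simp]: "shift_poly 1 f x = f x"
  by (simp flip: pCons_one)

lemma shift_poly_add_fun:
  "shift_poly p (\<lambda>x. f x + g x) x = shift_poly p f x + shift_poly p g x"
  by (induction p arbitrary: x) (simp_all add: algebra_simps)

lemma shift_poly_cmult_fun: "shift_poly p (\<lambda>x. c * f x) x = c * shift_poly p f x"
  by (induction p arbitrary: x) (simp_all add: algebra_simps)

lemma shift_poly_sum_fun: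
  "shift_poly p (\<lambda>x. \<Sum>i\<in>I. f i x) x = (\<Sum>i\<in>I. shift_poly p (f i) x)"
proof (induction I rule: infinite_finite_induct)
  case empty
  show ?case by (induction p arbitrary: x) simp_all
next
  case (infinite I)
  then show ?case by (induction p arbitrary: x) simp_all
qed (simp add: shift_poly_add_fun)

text \<open>Agreement along x, x + 1, ... is enough; this later permits replacing
  \<open>powr\<close> by an ordinary power at positive integers.\<close>

lemma shift_poly_cong:
  assumes "\<And>n. f (x + of_nat n) = g (x + of_nat n)"
  shows "shift_poly p f x = shift_poly p g x"
  using assms
proof (induction p arbitrary: x)
  case (pCons a p)
  have "shift_poly p f (x + 1) = shift_poly p g (x + 1)"
  proof (rule pCons.IH)
    show "f (x + 1 + of_nat n) = g (x + 1 + of_nat n)" for n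
      using pCons.prems[of "Suc n"] by (simp add: add_ac)
  qed
  then show ?case
    using pCons.prems[of 0] by simp
qed simp

lemma shift_poly_translate: "shift_poly p (\<lambda>x. f (x + a)) x = shift_poly p f (x + a)"
  by (induction p arbitrary: x) (simp_all add: add_ac)

lemma shift_poly_mult: "shift_poly (p * q) f x = shift_poly p (shift_poly q f) x"
  by (induction p arbitrary: x) (simp_all add: shift_poly_add shift_poly_smult)

text \<open>Each factor E - 1 cancels the leading term of (x + 1)^r and leaves only powers below
  r.\<close>

lemma shift_poly_difference_power_monomial:
  "r < N \<Longrightarrow> shift_poly ([:-1, 1:] ^ N) (\<lambda>x. x ^ r) x = 0"
proof (induction N arbitrary: r x)
  case (Suc N)
  have "shift_poly [:-1, 1:] (\<lambda>x. x ^ r) = (\<lambda>x. \<Sum>k<r. of_nat (r choose k) * x ^ k)"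
  proof
    fix x :: complex
    have "(x + 1) ^ r = (\<Sum>k\<le>r. of_nat (r choose k) * x ^ k)"
      by (simp add: binomial_ring)
    also have "\<dots> = (\<Sum>k<r. of_nat (r choose k) * x ^ k) + x ^ r"
      by (simp flip: lessThan_Suc_atMost)
    finally show "shift_poly [:-1, 1:] (\<lambda>x. x ^ r) x = (\<Sum>k<r. of_nat (r choose k) * x ^ k)"
      by simp
  qed
  then have "shift_poly ([:-1, 1:] ^ Suc N) (\<lambda>x. x ^ r) x
      = (\<Sum>k<r. of_nat (r choose k) * shift_poly ([:-1, 1:] ^ N) (\<lambda>x. x ^ k) x)"
    by (simp only: power_Suc2 shift_poly_mult shift_poly_sum_fun shift_poly_cmult_fun)
  also have "\<dots> = 0"
    using Suc by (intro sum.neutral) auto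
  finally show ?case .
qed simp

lemma shift_poly_difference_power_poly:
  assumes "degree P < N"
  shows "shift_poly ([:-1, 1:] ^ N) (poly P) x = 0"
proof -
  have "shift_poly ([:-1, 1:] ^ N) (poly P) x
      = (\<Sum>i\<le>degree P. coeff P i * shift_poly ([:-1, 1:] ^ N) (\<lambda>x. x ^ i) x)"
    by (simp only: poly_altdef[abs_def] shift_poly_sum_fun shift_poly_cmult_fun)
  also have "\<dots> = 0"
    using assms by (intro sum.neutral) (auto simp: shift_poly_difference_power_monomial)
  finally show ?thesis .
qed

text \<open>Division by \<open>1 - X ^ q\<close> in the completed local ring at \<open>X = 1\<close>, truncated at order \<open>N\<close>.\<close>

lemma poly_quotient_at_1:
  fixes S :: "complex poly"
  assumes "poly S 1 = 0" and "q > 0"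
  obtains C V where "S = (1 - monom 1 q) * C + [:-1, 1:] ^ N * V"
proof -
  define Phi :: "complex poly" where "Phi = (\<Sum>i<q. monom 1 i)"
  have Phi: "1 - monom 1 q = - ([:-1, 1:] * Phi)"
  proof -
    have "[:0, 1:] ^ q - 1 = ([:0, 1:] - 1 :: complex poly) * (\<Sum>i<q. [:0, 1:] ^ i)"
      by (rule power_diff_1_eq)
    then show ?thesis
      by (simp add: Phi_def monom_altdef one_pCons algebra_simps)
  qed
  have Phi1: "poly Phi 1 = of_nat q"
    by (simp add: Phi_def poly_sum poly_monom)
  have "\<exists>C V. S = (1 - monom 1 q) * C + [:-1, 1:] ^ Suc N * V" for N
  proof (induction N)
    case 0
    have "[:-1, 1:] dvd S"
      using assms(1) by (simp add: poly_eq_0_iff_dvd)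
    then obtain V where "S = [:-1, 1:] * V" by (elim dvdE)
    then show ?case by (intro exI[of _ 0] exI[of _ V]) simp
  next
    case (Suc N)
    then obtain C V where S: "S = (1 - monom 1 q) * C + [:-1, 1:] ^ Suc N * V" by blast
    \<comment> \<open>Since Phi(1) = q is nonzero, this \<open>c\<close> makes V + c Phi vanish at
      1, which yields one more factor X - 1. The correction is absorbed into C, because 1 - X^q =
      -(X - 1) Phi.\<close>
    define c where "c = - poly V 1 / of_nat q"
    have "poly (V + smult c Phi) 1 = 0"
      using assms(2) by (simp add: c_def Phi1)
    then have "[:-1, 1:] dvd V + smult c Phi"
      unfolding poly_eq_0_iff_dvd .
    then obtain V' where V': "V + smult c Phi = [:-1, 1:] * V'"
      by (rule dvdE)
    then have V: "V = [:-1, 1:] * V' - smult c Phi"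
      by (metis add_diff_cancel_right')
    have "(1 - monom 1 q) * (C + smult c ([:-1, 1:] ^ N)) + [:-1, 1:] ^ Suc (Suc N) * V' =
      (1 - monom 1 q) * C + [:-1, 1:] ^ Suc N * ([:-1, 1:] * V' - smult c Phi)"
      unfolding Phi by (simp only: power_Suc2 algebra_simps smult_add_right mult_smult_right
          mult_smult_left mult_minus_left mult_minus_right smult_minus_right add_minus_cancel)
    then show ?case using S V by metis
  qed
  \<comment> \<open>The induction starts at exponent 1, where S(1) = 0 is used; giving one factor
    back to \<open>V\<close> covers N = 0 as well.\<close>
  from this[of N] obtain C V where "S = (1 - monom 1 q) * C + [:-1, 1:] ^ Suc N * V" by blast
  then have "S = (1 - monom 1 q) * C + [:-1, 1:] ^ N * ([:-1, 1:] * V)"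
    by (simp only: power_Suc2 mult.assoc)
  then show thesis by (rule that)
qed

section \<open>Differences of complex powers\<close>

text \<open>Serves to move a bound from u in [x, x + 1] to x >= 1 at the cost of a factor 2 powr
  |e|, for exponents of either sign.\<close>

lemma powr_le_of_ratio_le:
  fixes x u c e :: real
  assumes "0 < x" "x \<le> u" "u \<le> c * x" "1 \<le> c"
  shows "u powr e \<le> c powr \<bar>e\<bar> * x powr e"
proof (cases "e \<ge> 0")
  case True
  have "u powr e \<le> (c * x) powr e"
    using assms True by (intro powr_mono2) auto
  then show ?thesis using assms True by (simp add: powr_mult)
next
  case False
  have "u powr e \<le> 1 * x powr e"
    using assms False powr_mono2'[of e x u] by simp
  also have "\<dots> \<le> c powr \<bar>e\<bar> * x powr e"
    using assms by (intro mult_right_mono ge_one_powr_ge_zero) auto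
  finally show ?thesis .
qed

lemma shift_poly_has_field_derivative:
  assumes "\<And>z. Re z > 0 \<Longrightarrow> (f has_field_derivative f' z) (at z)" and "Re z > 0"
  shows "(shift_poly p f has_field_derivative shift_poly p f' z) (at z)"
  using assms(2)
proof (induction p arbitrary: z)
  case 0
  have "shift_poly 0 f = (\<lambda>_. 0)" by auto
  then show ?case by simp
next
  case (pCons a p)
  have "(shift_poly p f has_field_derivative shift_poly p f' (z + 1)) (at (z + 1))"
    using pCons by simp
  then have "((\<lambda>z. shift_poly p f (z + 1)) has_field_derivative shift_poly p f' (z + 1)) (at z)"
    by (simp add: DERIV_shift)
  then have "((\<lambda>z. a * f z + shift_poly p f (z + 1)) has_field_derivative
      a * f' z + shift_poly p f' (z + 1)) (at z)"
    using assms(1)[OF pCons.prems] by (auto intro!: derivative_eq_intros)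
  moreover have "shift_poly (pCons a p) f = (\<lambda>z. a * f z + shift_poly p f (z + 1))"
    by auto
  ultimately show ?case by simp
qed

lemma holomorphic_on_shift_poly_powr:
  "Re w > 0 \<Longrightarrow> (\<lambda>s. shift_poly p (\<lambda>z. z powr (- s)) w) holomorphic_on A"
proof (induction p arbitrary: w)
  case (pCons a p)
  have "w \<noteq> 0" using pCons.prems by auto
  then show ?case using pCons by (auto intro!: holomorphic_intros)
qed simp

text \<open>Each difference gains a factor 1/x by the mean value inequality, since the derivative of
  (E - 1)^N z^(-s) is -s (E - 1)^N z^(-s-1). The hypothesis is thus applied at s + 1, which is why
  \<open>R\<close> varies in the induction. \<open>K\<close> is uniform in s, as the Weierstrass
  test will require.\<close>

lemma norm_difference_power_powr_le:
  fixes R :: real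
  shows "\<exists>K\<ge>0. \<forall>s x. cmod s \<le> R \<longrightarrow> x \<ge> 1 \<longrightarrow>
    cmod (shift_poly ([:-1, 1:] ^ N) (\<lambda>z. z powr (- s)) (of_real x)) \<le> K * x powr (- Re s - real N)"
proof (induction N arbitrary: R)
  case 0
  show ?case
    by (intro exI[of _ 1]) (auto simp: norm_powr_real_powr)
next
  case (Suc N)
  obtain K where K: "K \<ge> 0" and bound: "\<And>s x. cmod s \<le> R + 1 \<Longrightarrow> x \<ge> 1 \<Longrightarrow>
    cmod (shift_poly ([:-1, 1:] ^ N) (\<lambda>z. z powr (- s)) (of_real x)) \<le> K * x powr (- Re s - real N)"
    using Suc[of "R + 1"] by blast
  \<comment> \<open>\<open>E\<close> bounds the modulus of the exponent -Re s - (N + 1) for all s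
    with |s| <= R. In \<open>K'\<close>, the factor |R| bounds |s| and 2 powr E pays for passing
    from u to x.\<close>
  define E where "E = \<bar>R\<bar> + real N + 1"
  define K' where "K' = \<bar>R\<bar> * (K * 2 powr E)"
  have "K' \<ge> 0" using K by (simp add: K'_def)
  moreover have "cmod (shift_poly ([:-1, 1:] ^ Suc N) (\<lambda>z. z powr (- s)) (of_real x))
      \<le> K' * x powr (- Re s - real (Suc N))" if s: "cmod s \<le> R" and x: "x \<ge> 1" for s x
  proof -
    define g where "g = shift_poly ([:-1, 1:] ^ N) (\<lambda>z. z powr (- s))"
    define g' where "g' = (\<lambda>z. - s * shift_poly ([:-1, 1:] ^ N) (\<lambda>z. z powr (- (s + 1))) z)"
    have "shift_poly ([:-1, 1:] ^ Suc N) (\<lambda>z. z powr (- s)) (of_real x)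
        = g (of_real x + 1) - g (of_real x)"
      by (simp add: g_def shift_poly_mult shift_poly_diff algebra_simps del: mult_pCons_left)
    moreover have "cmod (g (of_real x + 1) - g (of_real x)) \<le>
        (K' * x powr (- Re s - real (Suc N))) * cmod ((of_real x + 1) - of_real x)"
    proof (rule field_differentiable_bound)
      show "convex (closed_segment (complex_of_real x) (of_real x + 1))" by simp
    next
      fix z assume "z \<in> closed_segment (complex_of_real x) (of_real x + 1)"
      then obtain t where t: "0 \<le> t" "t \<le> 1" "z = (1 - t) *\<^sub>R of_real x + t *\<^sub>R (of_real x + 1)"
        by (auto simp: in_segment)
      define u where "u = x + t"
      have z: "z = of_real u" and u: "x \<le> u" "u \<le> x + 1"
        using t by (auto simp: u_def scaleR_conv_of_real algebra_simps)
      have "((\<lambda>z. z powr (- s)) has_field_derivative - s * z powr (- (s + 1))) (at z)"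
        if "Re z > 0" for z
        using has_field_derivative_powr[of z "- s"] that by (auto simp: complex_nonpos_Reals_iff)
      then have "(g has_field_derivative
          shift_poly ([:-1, 1:] ^ N) (\<lambda>z. - s * z powr (- (s + 1))) z) (at z)"
        unfolding g_def by (rule shift_poly_has_field_derivative) (use u x z in auto)
      then show "(g has_field_derivative g' z)
          (at z within closed_segment (complex_of_real x) (of_real x + 1))"
        unfolding g'_def shift_poly_cmult_fun by (rule has_field_derivative_at_within)
      have s1: "cmod (s + 1) \<le> R + 1"
        using s norm_triangle_ineq[of s 1] by simp
      define e where "e = - Re s - real (Suc N)"
      have "\<bar>e\<bar> \<le> E"
        using abs_Re_le_cmod[of s] s by (auto simp: e_def E_def)
      have e_eq: "e = - Re (s + 1) - real N"
        by (simp add: e_def)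
      have "cmod (g' z) \<le> cmod s * (K * u powr e)"
        unfolding g'_def z norm_mult norm_minus_cancel e_eq
        using bound[OF s1, of u] u x by (intro mult_left_mono) auto
      also have "u powr e \<le> 2 powr \<bar>e\<bar> * x powr e"
        using u x by (intro powr_le_of_ratio_le) auto
      also have "2 powr \<bar>e\<bar> \<le> 2 powr E"
        using \<open>\<bar>e\<bar> \<le> E\<close> by simp
      finally have "cmod (g' z) \<le> cmod s * (K * (2 powr E * x powr e))"
        using K by (simp add: mult_left_mono mult_right_mono)
      also have "\<dots> \<le> \<bar>R\<bar> * (K * (2 powr E * x powr e))"
        using s K by (intro mult_right_mono) auto
      finally show "cmod (g' z) \<le> K' * x powr (- Re s - real (Suc N))"
        by (simp add: K'_def e_def mult.assoc)
    qed auto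
    ultimately show ?thesis by simp
  qed
  ultimately show ?case by blast
qed

text \<open>The order of quantifiers matters: \<open>M\<close> depends on \<open>p\<close> and
  \<open>E\<close> alone, so uniformity in s survives when \<open>h\<close>, \<open>K\<close> and
  \<open>e\<close> depend on s.\<close>

lemma norm_shift_poly_le:
  fixes E :: real
  shows "\<exists>M\<ge>0. \<forall>h K e x. \<bar>e\<bar> \<le> E \<longrightarrow> (\<forall>x\<ge>1. cmod (h (of_real x)) \<le> K * x powr e) \<longrightarrow> x \<ge> 1 \<longrightarrow>
    cmod (shift_poly p h (of_real x)) \<le> M * (K * x powr e)"
proof (induction p)
  case 0
  show ?case by (intro exI[of _ 0]) auto
next
  case (pCons a p)
  obtain M where M: "M \<ge> 0" and bound: "\<And>h K e x. \<lbrakk>\<bar>e\<bar> \<le> E; \<forall>x\<ge>1. cmod (h (of_real x)) \<le> K * x powr e;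
      x \<ge> 1\<rbrakk> \<Longrightarrow> cmod (shift_poly p h (of_real x)) \<le> M * (K * x powr e)"
    using pCons.IH by blast
  have "cmod (shift_poly (pCons a p) h (of_real x)) \<le> (cmod a + M * 2 powr E) * (K * x powr e)"
    if e: "\<bar>e\<bar> \<le> E" and h: "\<forall>x\<ge>1. cmod (h (of_real x)) \<le> K * x powr e" and x: "x \<ge> 1" for h K e x
  proof -
    have "0 \<le> cmod (h (of_real 1))" by simp
    also have "\<dots> \<le> K" using h[rule_format, of 1] by simp
    finally have K: "K \<ge> 0" .
    have "cmod (shift_poly p h (of_real (x + 1))) \<le> M * (K * (x + 1) powr e)"
      using x by (intro bound[OF e h]) auto
    also have "(x + 1) powr e \<le> 2 powr \<bar>e\<bar> * x powr e"
      using x by (intro powr_le_of_ratio_le) auto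
    also have "2 powr \<bar>e\<bar> \<le> 2 powr E"
      using e by simp
    finally have "cmod (shift_poly p h (of_real (x + 1))) \<le> M * (K * (2 powr E * x powr e))"
      using K M by (simp add: mult_left_mono mult_right_mono)
    moreover have "cmod (a * h (of_real x)) \<le> cmod a * (K * x powr e)"
      using h x by (simp add: norm_mult mult_left_mono)
    ultimately have "cmod (a * h (of_real x)) + cmod (shift_poly p h (of_real (x + 1)))
        \<le> (cmod a + M * 2 powr E) * (K * x powr e)"
      by (simp add: algebra_simps)
    then show ?thesis
      using norm_triangle_ineq[of "a * h (of_real x)" "shift_poly p h (of_real (x + 1))"] by simp
  qed
  moreover have "cmod a + M * 2 powr E \<ge> 0" using M by simp
  ultimately show ?case by blast
qed

text \<open>Used twice: for general N to dominate the series of differences, and for N = 0 to make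
  the boundary term of the telescoping sum vanish.\<close>

lemma norm_shift_poly_powr_le:
  fixes R :: real
  obtains K where "K \<ge> 0" "\<And>s x. cmod s \<le> R \<Longrightarrow> x \<ge> 1 \<Longrightarrow>
    cmod (shift_poly ([:-1, 1:] ^ N * V) (\<lambda>z. z powr (- s)) (of_real x)) \<le> K * x powr (- Re s - real N)"
proof -
  obtain K where K: "K \<ge> 0" and bound: "\<And>s x. cmod s \<le> R \<Longrightarrow> x \<ge> 1 \<Longrightarrow>
    cmod (shift_poly ([:-1, 1:] ^ N) (\<lambda>z. z powr (- s)) (of_real x)) \<le> K * x powr (- Re s - real N)"
    using norm_difference_power_powr_le[of R N] by blast
  obtain M where M: "M \<ge> 0" and M_bound: "\<And>h K e x. \<lbrakk>\<bar>e\<bar> \<le> R + real N;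
      \<forall>x\<ge>1. cmod (h (of_real x)) \<le> K * x powr e; x \<ge> 1\<rbrakk>
    \<Longrightarrow> cmod (shift_poly V h (of_real x)) \<le> M * (K * x powr e)"
    using norm_shift_poly_le[of "R + real N" V] by blast
  have "cmod (shift_poly ([:-1, 1:] ^ N * V) (\<lambda>z. z powr (- s)) (of_real x))
      \<le> M * K * x powr (- Re s - real N)" if s: "cmod s \<le> R" and x: "x \<ge> 1" for s x
  proof -
    have "\<bar>- Re s - real N\<bar> \<le> R + real N"
      using abs_Re_le_cmod[of s] s by auto
    then have "cmod (shift_poly V (shift_poly ([:-1, 1:] ^ N) (\<lambda>z. z powr (- s))) (of_real x))
        \<le> M * (K * x powr (- Re s - real N))"
      using bound[OF s] x by (intro M_bound) auto
    then show ?thesis by (simp only: mult.commute[of _ V] shift_poly_mult mult.assoc)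
  qed
  moreover have "M * K \<ge> 0" using M K by simp
  ultimately show thesis using that by blast
qed

section \<open>Dirichlet series with periodic coefficients of mean zero\<close>

lemma series_tendsto_suminf_of_multiples:
  fixes f :: "nat \<Rightarrow> 'a :: real_normed_vector"
  assumes "summable f" and "q > 0" and "(\<lambda>M. \<Sum>n<M * q. f n) \<longlonglongrightarrow> l"
  shows "suminf f = l"
proof -
  have "strict_mono (\<lambda>M. M * q)"
    using assms(2) by (auto simp: strict_mono_def)
  then have "(\<lambda>M. \<Sum>n<M * q. f n) \<longlonglongrightarrow> suminf f"
    using LIMSEQ_subseq_LIMSEQ[OF summable_LIMSEQ[OF assms(1)]] by (simp add: o_def)
  then show ?thesis using assms(3) LIMSEQ_unique by blast
qed

text \<open>By the identity theorem the \<open>F N\<close> agree on nested half-planes, so at s any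
  index beyond 1 - Re s may be used; the ceiling of 2 - Re s is one.\<close>

lemma analytic_continuation_half_planes:
  fixes F :: "nat \<Rightarrow> complex \<Rightarrow> complex"
  assumes hol: "\<And>N. F N holomorphic_on {s. Re s > 1 - real N}"
    and eq: "\<And>N s. Re s > 1 \<Longrightarrow> F N s = D s"
  obtains G where "G holomorphic_on UNIV" "\<And>N s. Re s > 1 - real N \<Longrightarrow> G s = F N s"
proof -
  have agree: "F N s = F M s" if "Re s > 1 - real N" "N \<le> M" for N M s
  proof (rule analytic_continuation_open[of "{s. Re s > 1}" "{s. Re s > 1 - real N}" "F N" "F M"])
    show "F N holomorphic_on {s. Re s > 1 - real N}" by (rule hol)
    show "F M holomorphic_on {s. Re s > 1 - real N}"
      by (rule holomorphic_on_subset[OF hol]) (use that in auto)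
    show "{s::complex. Re s > 1} \<noteq> {}" by (auto intro: exI[of _ 2])
    show "connected {s. Re s > 1 - real N}"
      by (intro convex_connected convex_halfspace_Re_gt)
  qed (use that in \<open>auto simp: open_halfspace_Re_gt eq\<close>)
  define G where "G = (\<lambda>s. F (nat \<lceil>2 - Re s\<rceil>) s)"
  have G: "G s = F N s" if "Re s > 1 - real N" for N s
  proof -
    define M where "M = nat \<lceil>2 - Re s\<rceil>"
    have "Re s > 1 - real M" unfolding M_def by linarith
    then show ?thesis
      using agree[of N s M] agree[of M s N] that by (cases "N \<le> M") (auto simp: G_def M_def)
  qed
  have "G holomorphic_on (\<Union>N. {s. Re s > 1 - real N})"
  proof (rule holomorphic_on_UN_open)
    fix N
    show "G holomorphic_on {s. Re s > 1 - real N}"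
      using hol[of N] by (rule holomorphic_transform) (auto simp: G)
  qed (auto simp: open_halfspace_Re_gt)
  moreover have "(\<Union>N. {s. Re s > 1 - real N}) = UNIV"
  proof -
    have "\<exists>N. Re s > 1 - real N" for s
      using reals_Archimedean2[of "1 - Re s"] by (auto simp: algebra_simps)
    then show ?thesis by auto
  qed
  ultimately show thesis using that G by simp
qed

lemma periodic_add_mult:
  fixes f :: "nat \<Rightarrow> 'a"
  assumes "\<And>n. f (n + q) = f n"
  shows "f (n + l * q) = f n"
  by (induction l) (simp_all add: assms add.assoc[symmetric] add.commute[of q])

text \<open>Continuation and special values are derived from periodicity and mean zero; characters
  are fed in through \<open>dirichlet_character_mean_zero\<close>.\<close>

locale mean_zero_periodic =
  fixes q :: nat and chi :: "nat \<Rightarrow> complex"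
  assumes q_pos: "q > 0"
    and periodic: "chi (n + q) = chi n"
    and mean_zero: "(\<Sum>m<q. chi (Suc m)) = 0"
begin

definition dseries :: "complex \<Rightarrow> complex" where
  "dseries s = (\<Sum>n. chi (Suc n) / of_nat (Suc n) powr s)"

text \<open>The polynomial S(X); the exponent lags the argument of \<open>chi\<close> by one because
  the operators are applied from x = 1.\<close>

definition gen_poly :: "complex poly" where
  "gen_poly = (\<Sum>m<q. monom (chi (Suc m)) m)"

lemma summable_dseries:
  assumes "Re s > 1"
  shows "summable (\<lambda>n. chi (Suc n) / of_nat (Suc n) powr s)"
proof (rule summable_comparison_test)
  define B where "B = (\<Sum>m<q. cmod (chi m))"
  have B: "cmod (chi n) \<le> B" for n
  proof -
    have "chi n = chi (n mod q)"
      using periodic_add_mult[of chi q "n mod q" "n div q", OF periodic] by simp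
    then show ?thesis
      using q_pos unfolding B_def by (auto intro!: member_le_sum)
  qed
  show "\<exists>N. \<forall>n\<ge>N. cmod (chi (Suc n) / of_nat (Suc n) powr s) \<le> B * real (Suc n) powr (- Re s)"
  proof (intro exI[of _ 0] allI impI)
    fix n
    have "cmod (chi (Suc n) / of_nat (Suc n) powr s) = cmod (chi (Suc n)) * real (Suc n) powr (- Re s)"
      by (simp add: norm_divide norm_mult norm_inverse norm_powr_real_powr powr_minus divide_inverse
          del: of_nat_Suc)
    then show "cmod (chi (Suc n) / of_nat (Suc n) powr s) \<le> B * real (Suc n) powr (- Re s)"
      using B by (simp add: mult_right_mono del: of_nat_Suc)
  qed
  have "summable (\<lambda>n. real n powr (- Re s))"
    using assms by (simp add: summable_real_powr_iff)
  then show "summable (\<lambda>n. B * real (Suc n) powr (- Re s))"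
    by (intro summable_mult) (subst summable_Suc_iff)
qed

lemma shift_poly_gen_poly:
  "shift_poly gen_poly f x = (\<Sum>m<q. chi (Suc m) * f (x + of_nat m))"
  by (simp add: gen_poly_def shift_poly_sum shift_poly_monom)

lemma sum_blocks:
  "(\<Sum>n<M * q. chi (Suc n) * f (of_nat (Suc n))) = (\<Sum>l<M. shift_poly gen_poly f (1 + of_nat (l * q)))"
proof (induction M)
  case (Suc M)
  have "(\<Sum>n<Suc M * q. chi (Suc n) * f (of_nat (Suc n))) =
      (\<Sum>n<M * q. chi (Suc n) * f (of_nat (Suc n))) +
      (\<Sum>m<q. chi (Suc (m + M * q)) * f (of_nat (Suc (m + M * q))))"
    using sum.nat_group[of "\<lambda>n. chi (Suc n) * f (of_nat (Suc n))" q "Suc M"]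
      sum.nat_group[of "\<lambda>n. chi (Suc n) * f (of_nat (Suc n))" q M]
      sum.shift_bounds_nat_ivl[of "\<lambda>n. chi (Suc n) * f (of_nat (Suc n))" 0 "M * q" q]
    by (simp add: lessThan_atLeast0 add.commute)
  also have "(\<Sum>m<q. chi (Suc (m + M * q)) * f (of_nat (Suc (m + M * q)))) =
      shift_poly gen_poly f (1 + of_nat (M * q))"
    using periodic_add_mult[of chi q "Suc _" M, OF periodic] by (simp add: shift_poly_gen_poly add_ac)
  finally show ?case by (simp only: Suc.IH sum.lessThan_Suc)
qed simp

lemma shift_poly_1_minus_monom:
  "shift_poly ((1 - monom 1 q) * C) f x = shift_poly C f x - shift_poly C f (x + of_nat q)"
  by (simp add: shift_poly_mult shift_poly_diff shift_poly_monom)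

text \<open>\<open>F\<close> is C(E) z^(-s) at 1 plus a series of N-th differences over the blocks.
  The special values are part of the statement because the decomposition defining \<open>F\<close>
  is not visible outside.\<close>

lemma half_plane_continuation:
  "\<exists>F. F holomorphic_on {s. Re s > 1 - real N} \<and> (\<forall>s. Re s > 1 \<longrightarrow> F s = dseries s) \<and>
    (\<forall>r P. (\<forall>x. poly P (x + of_nat q) - poly P x = x ^ r) \<longrightarrow> degree P < N \<longrightarrow> r < N \<longrightarrow>
       F (- of_nat r) = - (\<Sum>m<q. chi (Suc m) * poly P (of_nat (Suc m))))"
proof -
  have "poly gen_poly 1 = 0"
    using mean_zero by (simp add: gen_poly_def poly_sum poly_monom)
  then obtain C V where gen: "gen_poly = (1 - monom 1 q) * C + [:-1, 1:] ^ N * V"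
    using poly_quotient_at_1[of gen_poly q N] q_pos by blast
  define W where "W = [:-1, 1:] ^ N * V"
  define g where "g = (\<lambda>l s. shift_poly W (\<lambda>z. z powr (- s)) (1 + of_nat (l * q)))"
  define F where "F = (\<lambda>s. shift_poly C (\<lambda>z. z powr (- s)) 1 + (\<Sum>l. g l s))"
  have g_uniform: "\<exists>d>0. cball s d \<subseteq> {s. Re s > 1 - real N} \<and>
      uniform_limit (cball s d) (\<lambda>n s. \<Sum>l<n. g l s) (\<lambda>s. \<Sum>l. g l s) sequentially"
    if s: "Re s > 1 - real N" for s
  proof -
    \<comment> \<open>Half the distance from s to the boundary line: on the closed disc of radius
      \<open>d\<close> the exponent -Re s' - N stays at most -1 - d, which gives a summable
      majorant.\<close>
    define d where "d = (Re s - (1 - real N)) / 2"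
    have d: "d > 0" using s by (simp add: d_def)
    have Re_ge: "Re s' \<ge> 1 - real N + d" if "s' \<in> cball s d" for s'
      using that abs_Re_le_cmod[of "s - s'"] by (simp add: dist_norm d_def field_simps)
    obtain K where K: "K \<ge> 0" and bound: "\<And>s' x. cmod s' \<le> cmod s + d \<Longrightarrow> x \<ge> 1 \<Longrightarrow>
      cmod (shift_poly W (\<lambda>z. z powr (- s')) (of_real x)) \<le> K * x powr (- Re s' - real N)"
      using norm_shift_poly_powr_le[where R = "cmod s + d" and N = N and V = V]
      unfolding W_def by blast
    have "cmod (g l s') \<le> K * real (Suc l) powr (- 1 - d)" if s': "s' \<in> cball s d" for l s'
    proof -
      define x where "x = real (1 + l * q)"
      have "l \<le> l * q" using q_pos by simp
      then have x: "x \<ge> real (Suc l)" unfolding x_def by linarith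
      have "cmod s' \<le> cmod s + d"
        using s' norm_triangle_ineq2[of s' s] by (simp add: dist_norm norm_minus_commute)
      moreover have "g l s' = shift_poly W (\<lambda>z. z powr (- s')) (of_real x)"
        by (simp add: g_def x_def)
      ultimately have "cmod (g l s') \<le> K * x powr (- Re s' - real N)"
        using bound[of s' x] x by simp
      also have "x powr (- Re s' - real N) \<le> x powr (- 1 - d)"
        using Re_ge[OF s'] x by (intro powr_mono) auto
      also have "x powr (- 1 - d) \<le> real (Suc l) powr (- 1 - d)"
        using x d by (intro powr_mono2') auto
      finally show ?thesis using K by (simp add: mult_left_mono)
    qed
    moreover have "summable (\<lambda>l. K * real (Suc l) powr (- 1 - d))"
    proof -
      have "summable (\<lambda>n. real n powr (- 1 - d))"
        using d by (simp add: summable_real_powr_iff)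
      then show ?thesis by (intro summable_mult) (subst summable_Suc_iff)
    qed
    ultimately have "uniform_limit (cball s d) (\<lambda>n s. \<Sum>l<n. g l s) (\<lambda>s. \<Sum>l. g l s) sequentially"
      by (intro Weierstrass_m_test_ev[where M = "\<lambda>l. K * real (Suc l) powr (- 1 - d)"]
          always_eventually allI ballI)
    moreover have "cball s d \<subseteq> {s. Re s > 1 - real N}"
      using Re_ge d by fastforce
    ultimately show ?thesis using d by blast
  qed
  have Re_pos: "Re (1 + of_nat n) > 0" for n by simp
  have "(\<lambda>s. \<Sum>l. g l s) holomorphic_on {s. Re s > 1 - real N}"
  proof (rule holomorphic_uniform_sequence)
    show "(\<lambda>s. \<Sum>l<n. g l s) holomorphic_on {s. Re s > 1 - real N}" for n
      unfolding g_def by (intro holomorphic_on_sum holomorphic_on_shift_poly_powr Re_pos)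
  qed (use g_uniform in \<open>auto simp: open_halfspace_Re_gt\<close>)
  then have "F holomorphic_on {s. Re s > 1 - real N}"
    unfolding F_def by (intro holomorphic_on_add holomorphic_on_shift_poly_powr) auto
  moreover have "F s = dseries s" if s: "Re s > 1" for s
  proof -
    define f where "f = (\<lambda>z::complex. z powr (- s))"
    obtain d where "d > 0" and
      "uniform_limit (cball s d) (\<lambda>n s. \<Sum>l<n. g l s) (\<lambda>s. \<Sum>l. g l s) sequentially"
      using g_uniform[of s] s by auto
    then have lim_g: "(\<lambda>M. \<Sum>l<M. g l s) \<longlonglongrightarrow> (\<Sum>l. g l s)"
      by (intro tendsto_uniform_limitI) auto
    have partial: "(\<Sum>n<M * q. chi (Suc n) / of_nat (Suc n) powr s) =
        shift_poly C f 1 - shift_poly C f (1 + of_nat (M * q)) + (\<Sum>l<M. g l s)" for M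
    proof -
      have "(\<Sum>n<M * q. chi (Suc n) / of_nat (Suc n) powr s) =
          (\<Sum>n<M * q. chi (Suc n) * f (of_nat (Suc n)))"
        by (simp add: f_def powr_minus divide_inverse)
      also have "\<dots> = (\<Sum>l<M. shift_poly gen_poly f (1 + of_nat (l * q)))"
        by (rule sum_blocks)
      also have "\<dots> = (\<Sum>l<M. shift_poly C f (1 + of_nat (l * q)) - shift_poly C f (1 + of_nat (Suc l * q)))
          + (\<Sum>l<M. g l s)"
        unfolding gen by (simp add: shift_poly_add shift_poly_1_minus_monom sum.distrib g_def W_def
            f_def add_ac)
      also have "(\<Sum>l<M. shift_poly C f (1 + of_nat (l * q)) - shift_poly C f (1 + of_nat (Suc l * q)))
          = shift_poly C f 1 - shift_poly C f (1 + of_nat (M * q))"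
        by (subst sum_lessThan_telescope') simp
      finally show ?thesis .
    qed
    obtain K where K: "\<And>s' x. cmod s' \<le> cmod s \<Longrightarrow> x \<ge> 1 \<Longrightarrow>
      cmod (shift_poly ([:-1, 1:] ^ 0 * C) (\<lambda>z. z powr (- s')) (of_real x)) \<le>
        K * x powr (- Re s' - real 0)"
      using norm_shift_poly_powr_le[where R = "cmod s" and N = 0 and V = C] by blast
    have bound: "cmod (shift_poly C f (of_real x)) \<le> K * x powr (- Re s)" if "x \<ge> 1" for x
      using K[of s x] that by (simp add: f_def)
    have "(\<lambda>M. shift_poly C f (1 + of_nat (M * q))) \<longlonglongrightarrow> 0"
    proof (rule Lim_null_comparison)
      show "eventually (\<lambda>M. cmod (shift_poly C f (1 + of_nat (M * q))) \<le>
          K * real (1 + M * q) powr (- Re s)) sequentially"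
        using bound[of "real (1 + _ * q)"] by (intro always_eventually) simp
      have "filterlim (\<lambda>M. 1 + M * q) at_top sequentially"
        using q_pos by (intro filterlim_subseq) (auto simp: strict_mono_def)
      then have "filterlim (\<lambda>M. real (1 + M * q)) at_top sequentially"
        by (intro filterlim_compose[OF filterlim_real_sequentially])
      then have "(\<lambda>M. real (1 + M * q) powr (- Re s)) \<longlonglongrightarrow> 0"
        using s by (intro tendsto_neg_powr) auto
      then show "(\<lambda>M. K * real (1 + M * q) powr (- Re s)) \<longlonglongrightarrow> 0"
        by (rule tendsto_mult_right_zero)
    qed
    then have "(\<lambda>M. shift_poly C f 1 - shift_poly C f (1 + of_nat (M * q)) + (\<Sum>l<M. g l s))
        \<longlonglongrightarrow> shift_poly C f 1 - 0 + (\<Sum>l. g l s)"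
      by (intro tendsto_intros lim_g)
    then have "(\<lambda>M. \<Sum>n<M * q. chi (Suc n) / of_nat (Suc n) powr s) \<longlonglongrightarrow> F s"
      unfolding partial by (simp add: F_def f_def)
    then show ?thesis
      unfolding dseries_def
      using series_tendsto_suminf_of_multiples[OF summable_dseries[OF s] q_pos] by simp
  qed
  moreover have "F (- of_nat r) = - (\<Sum>m<q. chi (Suc m) * poly P (of_nat (Suc m)))"
    if P: "\<forall>x. poly P (x + of_nat q) - poly P x = x ^ r" and deg: "degree P < N" and r: "r < N" for r P
  proof -
    have vanish: "shift_poly W h x = 0"
      if "\<And>x. shift_poly ([:-1, 1:] ^ N) h x = 0" for h x
    proof -
      have "shift_poly W h x = shift_poly V (shift_poly ([:-1, 1:] ^ N) h) x"
        by (simp only: W_def mult.commute[of _ V] shift_poly_mult)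
      also have "\<dots> = shift_poly V (\<lambda>_. 0) x"
        using that by (intro shift_poly_cong) auto
      also have "\<dots> = 0" by (induction V arbitrary: x) simp_all
      finally show ?thesis .
    qed
    \<comment> \<open>All points met are positive integers, so the value of \<open>powr\<close> at 0
      never intervenes, not even for r = 0.\<close>
    have pow: "shift_poly p (\<lambda>z. z powr (- (- of_nat r))) (1 + of_nat n) =
        shift_poly p (\<lambda>z. z ^ r) (1 + of_nat n)" for p n
    proof (rule shift_poly_cong)
      fix k
      have "1 + of_nat n + of_nat k = (of_nat (Suc (n + k)) :: complex)" by simp
      then show "(1 + of_nat n + of_nat k :: complex) powr (- (- of_nat r)) = (1 + of_nat n + of_nat k) ^ r"
        by (simp del: of_nat_Suc)
    qed
    have "g l (- of_nat r) = 0" for l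
      unfolding g_def pow using r by (intro vanish shift_poly_difference_power_monomial)
    then have "F (- of_nat r) = shift_poly C (\<lambda>z. z ^ r) 1"
      using pow[of C 0] by (simp add: F_def)
    \<comment> \<open>Writing x^r as (E^q - 1) P turns C(E) x^r into -(1 - E^q) C(E) P, which is
      -S(E) P because (E - 1)^N kills P.\<close>
    also have "\<dots> = shift_poly C (\<lambda>x. poly P (x + of_nat q) + (-1) * poly P x) 1"
      by (simp add: P)
    also have "\<dots> = shift_poly C (poly P) (1 + of_nat q) - shift_poly C (poly P) 1"
      by (simp only: shift_poly_add_fun shift_poly_cmult_fun shift_poly_translate) simp
    also have "\<dots> = - shift_poly gen_poly (poly P) 1"
      using vanish[OF shift_poly_difference_power_poly[OF deg], of 1]
      unfolding gen shift_poly_add shift_poly_1_minus_monom W_def by simp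
    finally show ?thesis by (simp add: shift_poly_gen_poly)
  qed
  ultimately show ?thesis by blast
qed

lemma dirichlet_L_eq:
  assumes "\<And>x. poly P (x + of_nat q) - poly P x = x ^ r"
  shows "dirichlet_L chi (- of_nat r) = - (\<Sum>m<q. chi (Suc m) * poly P (of_nat (Suc m)))"
proof -
  have "\<forall>N. \<exists>F. F holomorphic_on {s. Re s > 1 - real N} \<and> (\<forall>s. Re s > 1 \<longrightarrow> F s = dseries s) \<and>
    (degree P < N \<longrightarrow> r < N \<longrightarrow>
       F (- of_nat r) = - (\<Sum>m<q. chi (Suc m) * poly P (of_nat (Suc m))))"
    (is "\<forall>N. \<exists>F. ?Q N F")
    using half_plane_continuation assms by meson
  then obtain F where F: "\<And>N. ?Q N (F N)"
    unfolding choice_iff by blast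
  obtain G where hol: "G holomorphic_on UNIV" and G: "\<And>N s. Re s > 1 - real N \<Longrightarrow> G s = F N s"
    by (rule analytic_continuation_half_planes[of F dseries]) (use F in auto)
  have "G s = dseries s" if "Re s > 1" for s
    using G[of 0 s] F[of 0] that by simp
  then have "dirichlet_L chi = G"
    unfolding dirichlet_L_def dseries_def[symmetric]
  proof (intro the_equality conjI allI impI hol ext)
    fix H s
    assume H: "H holomorphic_on UNIV \<and> (\<forall>s. Re s > 1 \<longrightarrow> H s = dseries s)"
    assume G_eq: "\<And>s. Re s > 1 \<Longrightarrow> G s = dseries s"
    show "H s = G s"
    proof (rule analytic_continuation_open[of "{s. Re s > 1}" UNIV H G])
      show "{s::complex. Re s > 1} \<noteq> {}" by (auto intro: exI[of _ 2])
    qed (use H hol G_eq in \<open>auto simp: open_halfspace_Re_gt\<close>)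
  qed auto
  \<comment> \<open>Large enough that N exceeds both degree P and r, and that -r lies in the
    half-plane Re s > 1 - N.\<close>
  moreover define N where "N = degree P + r + 2"
  ultimately have "dirichlet_L chi (- of_nat r) = F N (- of_nat r)"
    using G[of N "- of_nat r"] by simp
  also have "\<dots> = - (\<Sum>m<q. chi (Suc m) * poly P (of_nat (Suc m)))"
    using F[of N] by (simp add: N_def)
  finally show ?thesis .
qed

end

section \<open>Dirichlet characters\<close>

text \<open>Multiplication by a unit \<open>a\<close> with chi(a) different from 1 permutes the
  residues, so the sum equals chi(a) times itself. Passing from 0..q-1 to 1..q uses chi(q) =
  chi(0).\<close>

lemma dirichlet_character_mean_zero:
  assumes "dirichlet_character q chi" and "nontrivial_character q chi"
  shows "(\<Sum>m<q. chi (Suc m)) = 0"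
proof -
  have q: "q > 0" and mult: "\<And>m n. chi (m * n) = chi m * chi n" and per: "\<And>n. chi (n + q) = chi n"
    using assms(1) by (auto simp: dirichlet_character_def)
  have mod: "chi (n mod q) = chi n" for n
    using periodic_add_mult[of chi q "n mod q" "n div q", OF per] by simp
  obtain a where a: "coprime a q" "chi a \<noteq> 1"
    using assms(2) by (auto simp: nontrivial_character_def)
  have cancel: "m = n" if "(a * m) mod q = (a * n) mod q" "m \<le> n" "n < q" for m n
  proof -
    have "q dvd a * n - a * m"
      using that by (metis mod_eq_dvd_iff_nat mult_le_mono2)
    then have "q dvd a * (n - m)"
      by (simp add: diff_mult_distrib2)
    then have "q dvd n - m"
      using a(1) by (simp add: coprime_commute coprime_dvd_mult_right_iff)
    then show ?thesis
      using that by (auto dest: dvd_imp_le)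
  qed
  have "inj_on (\<lambda>m. (a * m) mod q) {..<q}"
  proof (rule inj_onI)
    fix m n assume "m \<in> {..<q}" "n \<in> {..<q}" "(a * m) mod q = (a * n) mod q"
    then show "m = n"
      using cancel[of m n] cancel[of n m] by (cases "m \<le> n") auto
  qed
  moreover have "(\<lambda>m. (a * m) mod q) ` {..<q} \<subseteq> {..<q}"
    using q by auto
  ultimately have "bij_betw (\<lambda>m. (a * m) mod q) {..<q} {..<q}"
    by (simp add: bij_betw_def endo_inj_surj)
  then have "(\<Sum>m<q. chi ((a * m) mod q)) = (\<Sum>m<q. chi m)"
    by (rule sum.reindex_bij_betw)
  then have "chi a * (\<Sum>m<q. chi m) = (\<Sum>m<q. chi m)"
    by (simp add: mod mult sum_distrib_left)
  then have "(\<Sum>m<q. chi m) = 0"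
    using a(2) by simp
  moreover have "(\<Sum>m<q. chi (Suc m)) + chi 0 = (\<Sum>m<q. chi m) + chi q"
    using sum.lessThan_Suc_shift[of chi q] by (simp add: add.commute)
  ultimately show ?thesis
    using per[of 0] by simp
qed

theorem theorem2:
  fixes q r :: nat and chi :: "nat \<Rightarrow> complex"
  assumes "dirichlet_character q chi" and "nontrivial_character q chi"
  shows "dirichlet_L chi (- of_nat r) =
    fact r * of_nat q ^ r *
      (\<Sum>k = 0..r. (-1) ^ (k + 1) * alpha k (- of_nat r) / fact (r + 1 - k) *
        (\<Sum>m = 1..q - 1. chi m *
           (\<Prod>i = 1..r + 1 - k. (of_nat m / of_nat q - of_nat i))))"
proof -
  interpret mean_zero_periodic q chi
    using assms dirichlet_character_mean_zero[OF assms]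
    by unfold_locales (auto simp: dirichlet_character_def)
  \<comment> \<open>The right-hand side of the theorem as a polynomial in m, with (-1)^k in place of
    (-1)^(k+1): the missing sign is supplied by \<open>dirichlet_L_eq\<close>.\<close>
  define P where "P = smult (fact r * of_nat q ^ r)
    (\<Sum>k = 0..r. smult ((-1) ^ k * alpha k (- of_nat r) / fact (r + 1 - k))
       (\<Prod>i = 1..r + 1 - k. [:- of_nat i, 1 / of_nat q:]))"
  have poly_P: "poly P x = fact r * of_nat q ^ r *
    (\<Sum>k = 0..r. (-1) ^ k * alpha k (- of_nat r) / fact (r + 1 - k) *
       (\<Prod>i = 1..r + 1 - k. (x / of_nat q - of_nat i)))" for x
    by (simp add: P_def poly_sum poly_prod)
  have prod_eq: "(\<Prod>i = 1..n. (y - of_nat i)) / fact n = (y - 1) gchoose n" for y :: complex and n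
    by (simp add: gbinomial_prod_rev prod.atLeast1_atMost_eq atLeast0LessThan algebra_simps)
  have poly_P': "poly P x = fact r * of_nat q ^ r *
    (\<Sum>k = 0..r. (-1) ^ k * alpha k (- of_nat r) * ((x / of_nat q - 1) gchoose Suc (r - k)))" for x
  proof -
    have "(-1) ^ k * alpha k (- of_nat r) / fact (r + 1 - k) *
        (\<Prod>i = 1..r + 1 - k. (x / of_nat q - of_nat i)) =
        (-1) ^ k * alpha k (- of_nat r) * ((x / of_nat q - 1) gchoose Suc (r - k))"
      if "k \<in> {0..r}" for k
      using that prod_eq[where n = "Suc (r - k)" and y = "x / of_nat q", symmetric]
      by (simp only: Suc_diff_le atLeastAtMost_iff Suc_eq_plus1[symmetric] times_divide_eq_left
          times_divide_eq_right)
    then show ?thesis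
      unfolding poly_P by (simp only: cong: sum.cong)
  qed
  \<comment> \<open>A shift of x by q is a shift of y = x / q by 1, so Pascal's rule lowers each
    binomial index by one and \<open>sum_alpha_gbinomial\<close> applies.\<close>
  have "poly P (x + of_nat q) - poly P x = x ^ r" for x
  proof -
    define y where "y = x / of_nat q"
    have y: "(x + of_nat q) / of_nat q = y + 1" "x = of_nat q * y"
      using q_pos by (simp_all add: y_def field_simps)
    have "poly P (x + of_nat q) - poly P x = fact r * of_nat q ^ r *
      (\<Sum>k = 0..r. (-1) ^ k * alpha k (- of_nat r) *
        ((y gchoose Suc (r - k)) - ((y - 1) gchoose Suc (r - k))))"
      unfolding poly_P' y(1) y_def[symmetric]
      by (simp add: right_diff_distrib sum_subtractf)
    also have "\<dots> = fact r * of_nat q ^ r *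
      (\<Sum>k = 0..r. (-1) ^ k * alpha k (- of_nat r) * ((y - 1) gchoose (r - k)))"
      using gbinomial_Suc_Suc[of "y - 1"] by simp
    also have "\<dots> = x ^ r"
      unfolding sum_alpha_gbinomial by (simp add: y(2) power_mult_distrib)
    finally show ?thesis .
  qed
  then have "dirichlet_L chi (- of_nat r) = - (\<Sum>m<q. chi (Suc m) * poly P (of_nat (Suc m)))"
    by (rule dirichlet_L_eq)
  also have "(\<Sum>m<q. chi (Suc m) * poly P (of_nat (Suc m))) = (\<Sum>m = 1..q. chi m * poly P (of_nat m))"
    by (simp only: One_nat_def sum.atLeast1_atMost_eq)
  also have "\<dots> = (\<Sum>m = 1..q - 1. chi m * poly P (of_nat m))"
  proof -
    \<comment> \<open>For q = 1 the mean would be chi(1) = 1. Hence q > 1, q is not coprime to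
      itself, and the term m = q drops out.\<close>
    have "q \<noteq> 1"
      using mean_zero assms(1) by (auto simp: dirichlet_character_def)
    then have "chi q = 0"
      using assms(1) by (simp add: dirichlet_character_def)
    then show ?thesis
      using q_pos by (cases q) simp_all
  qed
  also have "\<dots> = fact r * of_nat q ^ r *
    (\<Sum>k = 0..r. (-1) ^ k * alpha k (- of_nat r) / fact (r + 1 - k) *
      (\<Sum>m = 1..q - 1. chi m * (\<Prod>i = 1..r + 1 - k. (of_nat m / of_nat q - of_nat i))))"
    unfolding poly_P sum_distrib_left by (subst sum.swap) (simp only: mult_ac)
  finally show ?thesis
    by (simp add: sum_negf)
qed

end
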